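(* For all positive integers $k$ and $d$, there is a graph $G$ that is the union of $d$ comparability graphs such that $\omega(G)=k$ and $\chi(G)=k^d$.
   Context: Graphs are finite and simple. For a graph $G$, $\omega(G)$ denotes the clique number (the maximum size of a clique in $G$) and $\chi(G)$ denotes the chromatic number. A graph $G$ is the union of graphs $G_1,\ldots,G_d$ if $V(G)=V(G_1)\cup\cdots\cup V(G_d)$ and $E(G)=E(G_1)\cup\cdots\cup E(G_d)$. A comparability graph is a graph whose vertex set is a partially ordered set $(P,\preceq)$, where two (distinct) vertices are adjacent if and only if they are comparable in $(P,\preceq)$. *)

theory Defs
  imports "Graph_Theory.Pair_Digraph"
begin

text \<open>
  Finite simple graphs are the symmetric, loop-free finite pair digraphs of locale
  \<^locale>\<open>pair_graph\<close>: the undirected edge between u and v is the pair of arcs (u, v), (v, u).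
\<close>

definition clique :: "'a pair_pre_digraph \<Rightarrow> 'a set \<Rightarrow> bool" where
  "clique G K \<longleftrightarrow> K \<subseteq> pverts G \<and> (\<forall>u\<in>K. \<forall>v\<in>K. u \<noteq> v \<longrightarrow> (u, v) \<in> parcs G)"

definition clique_number :: "'a pair_pre_digraph \<Rightarrow> nat" where
  "clique_number G = Max {card K |K. clique G K}"

definition proper_coloring :: "'a pair_pre_digraph \<Rightarrow> nat \<Rightarrow> ('a \<Rightarrow> nat) \<Rightarrow> bool" where
  "proper_coloring G n f \<longleftrightarrow>
     (\<forall>v\<in>pverts G. f v < n) \<and> (\<forall>(u, v)\<in>parcs G. f u \<noteq> f v)"

definition chromatic_number :: "'a pair_pre_digraph \<Rightarrow> nat" where
  "chromatic_number G = (LEAST n. \<exists>f. proper_coloring G n f)"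

definition comparability_graph :: "'a pair_pre_digraph \<Rightarrow> bool" where
  "comparability_graph G \<longleftrightarrow> pair_graph G \<and>
     (\<exists>r. partial_order_on (pverts G) r \<and>
          parcs G = {(u, v). u \<noteq> v \<and> ((u, v) \<in> r \<or> (v, u) \<in> r)})"

text \<open>The members of the family may have different, possibly overlapping, vertex sets.\<close>

definition graph_Union :: "('i \<Rightarrow> 'a pair_pre_digraph) \<Rightarrow> 'i set \<Rightarrow> 'a pair_pre_digraph" where
  "graph_Union H I = \<lparr> pverts = (\<Union>i\<in>I. pverts (H i)), parcs = (\<Union>i\<in>I. parcs (H i)) \<rparr>"

end

theory Submission
  imports Defs "HOL-Library.FuncSet"
begin

text \<open>
  By induction on d. Given a union G of d comparability graphs with clique number k and chromatic
  number at least c, build unions F(1), ..., F(k) of d + 1 comparability graphs with clique number k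
  and chromatic number at least j c for F(j). Start with F(1) = G and an empty top order. For
  F(j + 1), take many disjoint copies of G, and for every injection s of the pairs (w, v) of a vertex
  w of F(j) and a vertex v of G into the set of copies add a guest copy of F(j), where w and
  everything below w in the top order of F(j) is put below the vertex v of copy s(w, v). In a
  colouring with few colours, so many copies of G are coloured alike that some s uses only those;
  then no vertex of the guest belonging to s shares a colour with a vertex of such a copy, which
  gives c new colours.

  A clique meeting both G and a guest is a chain in the top order, because any two adjacent vertices
  below a common one in the top order are themselves top-comparable, and this order has only j + 1
  levels. Finally each order of the union has k levels, so the tuple of levels is a proper colouring
  with \<open>k ^ d\<close> colours.
\<close>

section \<open>Families of strict orders with level functions\<close>

definition comparable :: "(nat \<Rightarrow> 'a rel) \<Rightarrow> nat \<Rightarrow> 'a \<Rightarrow> 'a \<Rightarrow> bool" where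
  "comparable R d u v \<longleftrightarrow> (\<exists>i<d. (u, v) \<in> R i \<or> (v, u) \<in> R i)"

lemma comparable_sym: "comparable R d u v \<Longrightarrow> comparable R d v u"
  by (auto simp: comparable_def)

text \<open>
  The \<^term>\<open>R i\<close> are strict orders with level functions \<^term>\<open>h i\<close>, and \<^term>\<open>c\<close> is a lower
  bound for the chromatic number.
\<close>

locale order_system =
  fixes k d c :: nat and V :: "'a set" and R :: "nat \<Rightarrow> 'a rel" and h :: "nat \<Rightarrow> 'a \<Rightarrow> nat"
  assumes finite_V: "finite V"
    and R_subset: "i < d \<Longrightarrow> R i \<subseteq> V \<times> V"
    and R_trans: "i < d \<Longrightarrow> trans (R i)"
    and level_mono: "i < d \<Longrightarrow> (u, v) \<in> R i \<Longrightarrow> h i u < h i v"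
    and level_less: "i < d \<Longrightarrow> v \<in> V \<Longrightarrow> h i v < k"
    and clique_le: "K \<subseteq> V \<Longrightarrow> pairwise (comparable R d) K \<Longrightarrow> card K \<le> k"
    and clique_ex: "\<exists>K\<subseteq>V. pairwise (comparable R d) K \<and> card K = k"
    and colours_ge: "\<And>f :: 'a \<Rightarrow> nat.
      (\<And>i u v. i < d \<Longrightarrow> (u, v) \<in> R i \<Longrightarrow> f u \<noteq> f v) \<Longrightarrow> c \<le> card (f ` V)"

lemma (in order_system) R_irrefl: "i < d \<Longrightarrow> (v, v) \<notin> R i"
  using level_mono by blast

lemma (in order_system) comparable_irrefl: "\<not> comparable R d v v"
  using R_irrefl by (auto simp: comparable_def)

text \<open>Comparability is irreflexive, so a map that sends distinct elements of \<open>K\<close>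
  to comparable ones is injective and its image is a clique of the same size.\<close>

lemma (in order_system) clique_le_image:
  assumes "f ` K \<subseteq> V"
    and "\<And>x z. x \<in> K \<Longrightarrow> z \<in> K \<Longrightarrow> x \<noteq> z \<Longrightarrow> comparable R d (f x) (f z)"
  shows "card K \<le> k"
proof -
  have "inj_on f K"
    using assms(2) comparable_irrefl by (metis inj_onI)
  then show ?thesis
    using clique_le[of "f ` K"] assms by (simp add: card_image pairwise_imageI)
qed

text \<open>The last order \<open>R d\<close> is the one under construction, and \<open>j\<close>
  bounds the levels it occupies. \<open>fork\<close> is the invariant that turns a clique mixing
  copies and guests into a chain.\<close>

locale layered_system = order_system k "Suc d" c V R h
  for k d c :: nat and V :: "'a set" and R :: "nat \<Rightarrow> 'a rel" and h :: "nat \<Rightarrow> 'a \<Rightarrow> nat" +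
  fixes j :: nat
  assumes top_level_less: "v \<in> V \<Longrightarrow> h d v < j"
    and fork: "(u, w) \<in> R d \<Longrightarrow> (v, w) \<in> R d \<Longrightarrow> comparable R (Suc d) u v \<Longrightarrow>
      (u, v) \<in> R d \<or> (v, u) \<in> R d"

text \<open>Base case of the outer induction: the comparability graph of a chain of \<open>k\<close>
  elements is complete, so every vertex needs its own colour.\<close>

lemma order_system_chain:
  "order_system k 1 k {..<k} (\<lambda>_. {(u, v). u < v \<and> v < k}) (\<lambda>_ v. v)"
proof
  show "\<exists>K\<subseteq>{..<k}. pairwise (comparable (\<lambda>_. {(u, v). u < v \<and> v < k}) 1) K \<and> card K = k"
    by (rule exI[of _ "{..<k}"]) (auto simp: pairwise_def comparable_def)
next
  fix K assume "K \<subseteq> {..<k}"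
  then show "card K \<le> k"
    using card_mono[of "{..<k}" K] by simp
next
  fix f :: "nat \<Rightarrow> nat"
  assume *: "\<And>(i :: nat) u v. i < 1 \<Longrightarrow> (u, v) \<in> {(u, v). u < v \<and> v < k} \<Longrightarrow> f u \<noteq> f v"
  have "inj_on f {..<k}"
  proof (rule linorder_inj_onI')
    fix u v assume "u \<in> {..<k}" "v \<in> {..<k}" "u < v"
    then show "f u \<noteq> f v"
      using *[of 0 u v] by simp
  qed
  then show "k \<le> card (f ` {..<k})"
    by (simp add: card_image)
qed (auto simp: trans_def)

text \<open>Start of the inner induction. An empty top order leaves comparability unchanged and
  makes \<open>fork\<close> vacuous; level 0 is admissible because \<open>k > 0\<close>.\<close>

lemma (in order_system) layered_system_1:
  assumes "k > 0"
  shows "layered_system k d c V (R(d := {})) (h(d := \<lambda>_. 0)) 1"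
proof -
  have comparable_eq: "comparable (R(d := {})) (Suc d) = comparable R d"
    by (auto simp: fun_eq_iff comparable_def less_Suc_eq)
  show ?thesis
  proof
    show "(R(d := {})) i \<subseteq> V \<times> V" if "i < Suc d" for i
      using that R_subset[of i] by (auto simp: less_Suc_eq)
    show "trans ((R(d := {})) i)" if "i < Suc d" for i
      using that R_trans[of i] by (auto simp: less_Suc_eq)
    show "c \<le> card (f ` V)" if "\<And>i u v. i < Suc d \<Longrightarrow> (u, v) \<in> (R(d := {})) i \<Longrightarrow> f u \<noteq> f v"
      for f :: "'a \<Rightarrow> nat"
    proof (rule colours_ge)
      show "f u \<noteq> f v" if "i < d" "(u, v) \<in> R i" for i u v
        using that \<open>\<And>i u v. i < Suc d \<Longrightarrow> (u, v) \<in> (R(d := {})) i \<Longrightarrow> f u \<noteq> f v\<close>[of i u v] by simp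
    qed
  qed (use finite_V level_mono level_less clique_le clique_ex assms
      in \<open>auto simp: comparable_eq less_Suc_eq\<close>)
qed

text \<open>An amalgam lives on a larger type than its ingredients. Pulling it back along a
  bijection returns to sets of naturals, so that the induction can stay in one vertex type.\<close>

lemma (in layered_system) relabel:
  assumes "bij_betw p U V"
  shows "layered_system k d c U (\<lambda>i. {(u, v). u \<in> U \<and> v \<in> U \<and> (p u, p v) \<in> R i})
    (\<lambda>i u. h i (p u)) j"
    (is "layered_system k d c U ?R ?h j")
proof -
  have inj: "inj_on p U" and img: "p ` U = V"
    using assms by (auto simp: bij_betw_def)
  have comp: "comparable ?R e u v \<longleftrightarrow> comparable R e (p u) (p v)" if "u \<in> U" "v \<in> U" for e u v
    using that by (auto simp: comparable_def)
  have pw: "pairwise (comparable R (Suc d)) (p ` K) \<longleftrightarrow> pairwise (comparable ?R (Suc d)) K"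
    if "K \<subseteq> U" for K
    using that comp by (auto simp: pairwise_image pairwise_def subset_iff inj_on_eq_iff[OF inj])
  show ?thesis
  proof
    show "finite U"
      using finite_V assms bij_betw_finite by blast
  next
    fix i assume "i < Suc d"
    show "trans (?R i)"
      using R_trans[OF \<open>i < Suc d\<close>] unfolding trans_def by blast
  next
    fix K assume "K \<subseteq> U" "pairwise (comparable ?R (Suc d)) K"
    then show "card K \<le> k"
      using clique_le[of "p ` K"] pw[of K] img card_image[OF inj_on_subset[OF inj]]
      by (metis image_mono)
  next
    obtain K where K: "K \<subseteq> V" "pairwise (comparable R (Suc d)) K" "card K = k"
      using clique_ex by blast
    then obtain L where L: "L \<subseteq> U" "K = p ` L"
      using img by (metis subset_imageE)
    then show "\<exists>K\<subseteq>U. pairwise (comparable ?R (Suc d)) K \<and> card K = k"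
      using K pw[OF L(1)] card_image[OF inj_on_subset[OF inj L(1)]] by (intro exI[of _ L]) simp
  next
    fix f :: "'b \<Rightarrow> nat"
    assume f: "\<And>i u v. i < Suc d \<Longrightarrow> (u, v) \<in> ?R i \<Longrightarrow> f u \<noteq> f v"
    have "c \<le> card ((f \<circ> inv_into U p) ` V)"
    proof (rule colours_ge)
      fix i u v assume i: "i < Suc d" "(u, v) \<in> R i"
      then have "u \<in> p ` U" "v \<in> p ` U"
        using R_subset img by blast+
      then show "(f \<circ> inv_into U p) u \<noteq> (f \<circ> inv_into U p) v"
        using f[of i "inv_into U p u" "inv_into U p v"] i
        by (simp add: inv_into_into f_inv_into_f)
    qed
    moreover have "(f \<circ> inv_into U p) ` V = f ` U"
      using inj unfolding img[symmetric] by (simp add: image_image cong: image_cong_simp)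
    ultimately show "c \<le> card (f ` U)"
      by simp
  next
    fix u w v assume "(u, w) \<in> ?R d" "(v, w) \<in> ?R d" "comparable ?R (Suc d) u v"
    then show "(u, v) \<in> ?R d \<or> (v, u) \<in> ?R d"
      using fork[of "p u" "p w" "p v"] comp by auto
  qed (use level_mono level_less top_level_less img in auto)
qed

section \<open>Amalgamation of copies of a base system \<open>A\<close> with guest copies of a
  layered system \<open>B\<close>\<close>

locale amalgam = A: order_system k d c V R h + B: layered_system k d b W Q g j
  for k d c :: nat and V :: "'a set" and R and h and b and W :: "'b set" and Q and g and j +
  assumes j_less: "j < k"
begin

text \<open>Pigeonhole threshold: at most \<open>b + c\<close> colours give at most
  \<open>(b + c) ^ card V\<close> colour patterns on a copy, so some pattern occurs on more than
  \<open>card (W \<times> V)\<close> copies.\<close>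

definition copies :: nat where
  "copies = Suc ((b + c) ^ card V * card (W \<times> V))"

text \<open>Extensionality keeps this set finite. Injectivity lets the number of a copy reveal the
  pair \<open>(w, v)\<close> attached there.\<close>

definition placements :: "('b \<times> 'a \<Rightarrow> nat) set" where
  "placements = {s \<in> W \<times> V \<rightarrow>\<^sub>E {..<copies}. inj_on s (W \<times> V)}"

definition verts :: "(nat \<times> 'a + ('b \<times> 'a \<Rightarrow> nat) \<times> 'b) set" where
  "verts = ({..<copies} \<times> V) <+> (placements \<times> W)"

definition below :: "'b \<Rightarrow> 'b \<Rightarrow> bool" where
  "below w' w \<longleftrightarrow> w' = w \<or> (w', w) \<in> Q d"

text \<open>The vertex \<^term>\<open>Inl (y, v)\<close> is v in copy y; \<^term>\<open>Inr (s, w)\<close> is w in the guest belonging to s.\<close>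

inductive_set rel :: "nat \<Rightarrow> (nat \<times> 'a + ('b \<times> 'a \<Rightarrow> nat) \<times> 'b) rel" for i where
  base: "i < d \<Longrightarrow> y < copies \<Longrightarrow> (v, v') \<in> R i \<Longrightarrow> (Inl (y, v), Inl (y, v')) \<in> rel i"
| guest: "s \<in> placements \<Longrightarrow> (w, w') \<in> Q i \<Longrightarrow> (Inr (s, w), Inr (s, w')) \<in> rel i"
| top: "i = d \<Longrightarrow> s \<in> placements \<Longrightarrow> w \<in> W \<Longrightarrow> v \<in> V \<Longrightarrow> below w' w \<Longrightarrow>
    (Inr (s, w'), Inl (s (w, v), v)) \<in> rel i"

text \<open>In the top order every base vertex gets the new level \<open>j\<close>, above all guest
  vertices, whose top levels are less than \<open>j\<close>.\<close>

definition level :: "nat \<Rightarrow> nat \<times> 'a + ('b \<times> 'a \<Rightarrow> nat) \<times> 'b \<Rightarrow> nat" where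
  "level i = case_sum (\<lambda>(y, v). if i = d then j else h i v) (\<lambda>(s, w). g i w)"

lemma finite_verts: "finite verts"
proof -
  have "finite (W \<times> V \<rightarrow>\<^sub>E {..<copies})"
    using A.finite_V B.finite_V by (auto intro: finite_PiE)
  then have "finite placements"
    unfolding placements_def by simp
  then show ?thesis
    using A.finite_V B.finite_V by (simp add: verts_def)
qed

lemma placement_inj:
  "s \<in> placements \<Longrightarrow> s (w, v) = s (w', v') \<Longrightarrow> w \<in> W \<Longrightarrow> v \<in> V \<Longrightarrow> w' \<in> W \<Longrightarrow> v' \<in> V \<Longrightarrow>
    w = w' \<and> v = v'"
  by (auto simp: placements_def dest: inj_onD)

lemma placement_less: "s \<in> placements \<Longrightarrow> w \<in> W \<Longrightarrow> v \<in> V \<Longrightarrow> s (w, v) < copies"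
  by (auto simp: placements_def)

lemma below_W: "below w' w \<Longrightarrow> w \<in> W \<Longrightarrow> w' \<in> W"
  using B.R_subset[of d] by (auto simp: below_def)

lemma below_trans: "(w'', w') \<in> Q d \<Longrightarrow> below w' w \<Longrightarrow> below w'' w"
  using B.R_trans[of d] by (auto simp: below_def dest: transD)

lemma rel_Inl_Inl:
  "(Inl (y, v), Inl (y', v')) \<in> rel i \<longleftrightarrow> i < d \<and> y < copies \<and> y = y' \<and> (v, v') \<in> R i"
  by (auto elim: rel.cases intro: rel.base)

lemma rel_Inr_Inr:
  "(Inr (s, w), Inr (s', w')) \<in> rel i \<longleftrightarrow> s \<in> placements \<and> s = s' \<and> (w, w') \<in> Q i"
  by (auto elim: rel.cases intro: rel.guest)

lemma rel_Inl_Inr: "(Inl x, Inr z) \<notin> rel i"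
  by (auto elim: rel.cases)

lemma rel_Inr_Inl:
  "(Inr (s, w'), Inl (y, v)) \<in> rel i \<longleftrightarrow>
    i = d \<and> s \<in> placements \<and> v \<in> V \<and> (\<exists>w\<in>W. below w' w \<and> y = s (w, v))"
  by (auto elim: rel.cases intro: rel.top)

lemmas rel_simps = rel_Inl_Inl rel_Inr_Inr rel_Inl_Inr rel_Inr_Inl

lemma rel_subset: "i < Suc d \<Longrightarrow> rel i \<subseteq> verts \<times> verts"
proof (clarify, goal_cases)
  case (1 x z)
  from 1(2,1) show ?case
    using A.R_subset[of i] B.R_subset[of i]
    by cases (auto simp: verts_def placement_less dest: below_W)
qed

text \<open>Base arcs need \<open>i < d\<close> and top arcs need \<open>i = d\<close>, so the only
  mixed composite is a guest arc followed by a top arc. It is again a top arc because whole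
  down-sets are attached (\<open>below_trans\<close>).\<close>

lemma rel_trans:
  assumes "i < Suc d"
  shows "trans (rel i)"
proof (rule transI)
  fix x y z assume xy: "(x, y) \<in> rel i" and yz: "(y, z) \<in> rel i"
  from xy show "(x, z) \<in> rel i"
  proof cases
    case (base y v v')
    then show ?thesis
      using yz A.R_trans[of i] by (cases z) (auto simp: rel_simps dest: transD)
  next
    case (guest s w w')
    show ?thesis
    proof (cases z)
      case (Inl p)
      then show ?thesis
        using guest yz below_trans by (cases p) (fastforce simp: rel_simps)
    next
      case (Inr p)
      then show ?thesis
        using guest yz B.R_trans[OF assms] by (cases p) (auto simp: rel_simps dest: transD)
    qed
  next
    case (top s w v w')
    then show ?thesis
      using yz by (cases z) (auto simp: rel_simps)
  qed
qed

lemma level_mono: "i < Suc d \<Longrightarrow> (x, z) \<in> rel i \<Longrightarrow> level i x < level i z"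
  using A.level_mono[of i] B.level_mono[of i] B.top_level_less
  by (auto simp: level_def elim!: rel.cases dest: below_W)

lemma level_less: "i < Suc d \<Longrightarrow> x \<in> verts \<Longrightarrow> level i x < k"
  using A.level_less[of i] B.level_less[of i] j_less by (auto simp: level_def verts_def)

lemma top_level_less: "x \<in> verts \<Longrightarrow> level d x < Suc j"
  using B.top_level_less by (auto simp: level_def verts_def less_Suc_eq)

lemma comparable_Inl:
  "comparable rel (Suc d) (Inl (y, v)) (Inl (y', v')) \<Longrightarrow> y = y' \<and> comparable R d v v'"
  by (auto simp: comparable_def rel_simps)

lemma comparable_Inr:
  "comparable rel (Suc d) (Inr (s, w)) (Inr (s', w')) \<Longrightarrow>
    s \<in> placements \<and> s = s' \<and> comparable Q (Suc d) w w'"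
  by (auto simp: comparable_def rel_simps)

lemma comparable_Inr_Inl:
  "comparable rel (Suc d) (Inr x) (Inl z) \<Longrightarrow> (Inr x, Inl z) \<in> rel d"
  by (cases x; cases z) (auto simp: comparable_def rel_simps)

text \<open>Only guest vertices lie below something in \<open>rel d\<close>, and comparable ones
  belong to the same guest \<open>s\<close>. If \<open>t\<close> is a base vertex, injectivity of
  \<open>s\<close> leaves a single \<open>w0\<close> whose down-set is attached to \<open>t\<close>;
  if \<open>t\<close> is a guest vertex, it supplies \<open>w0\<close> itself. Then
  \<open>B.fork\<close> applies below \<open>w0\<close>.\<close>

lemma fork:
  assumes "(x, t) \<in> rel d" "(z, t) \<in> rel d" "comparable rel (Suc d) x z"
  shows "(x, z) \<in> rel d \<or> (z, x) \<in> rel d"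
proof -
  obtain s w where x: "x = Inr (s, w)"
    using assms(1) by cases auto
  obtain s' w' where z: "z = Inr (s', w')"
    using assms(2) by cases auto
  have s: "s' = s" "s \<in> placements" and ww': "comparable Q (Suc d) w w'"
    using assms(3) comparable_Inr unfolding x z by blast+
  have "\<exists>w0. below w w0 \<and> below w' w0"
  proof (cases t)
    case (Inl p)
    then obtain y v where t: "t = Inl (y, v)"
      by (cases p) auto
    show ?thesis
      using assms(1,2) placement_inj[OF s(2)] unfolding x z t s(1) rel_simps by metis
  next
    case (Inr p)
    then show ?thesis
      using assms(1,2) by (cases p) (auto simp: x z rel_simps below_def)
  qed
  then obtain w0 where "below w w0" "below w' w0"
    by blast
  moreover have "w \<noteq> w'"
    using ww' B.level_mono by (fastforce simp: comparable_def)
  ultimately have "(w, w') \<in> Q d \<or> (w', w) \<in> Q d"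
    using B.fork ww' by (auto simp: below_def)
  then show ?thesis
    by (auto simp: x z s rel_simps)
qed

text \<open>Pure cliques project to cliques of the base or guest system. A mixed clique has just one
  base vertex and everything else lies below it, so \<open>fork\<close> makes it a chain on
  \<open>Suc j \<le> k\<close> levels.\<close>

lemma clique_le:
  assumes K: "K \<subseteq> verts" and cl: "pairwise (comparable rel (Suc d)) K"
  shows "card K \<le> k"
proof -
  consider (mixed) x z where "Inl x \<in> K" "Inr z \<in> K"
    | (base) "K \<subseteq> range Inl" | (guest) "K \<subseteq> range Inr"
  proof (cases "K \<subseteq> range Inl \<or> K \<subseteq> range Inr")
    case False
    then obtain p q where "p \<in> K" "p \<notin> range Inl" "q \<in> K" "q \<notin> range Inr"
      by (meson subsetI)
    then show ?thesis
      using mixed by (cases p; cases q) auto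
  qed (use base guest in blast)
  then show ?thesis
  proof cases
    case base
    show ?thesis
    proof (rule A.clique_le_image[of "snd \<circ> projl"])
      show "(snd \<circ> projl) ` K \<subseteq> V"
        using K base by (auto simp: verts_def)
      show "comparable R d ((snd \<circ> projl) x) ((snd \<circ> projl) z)"
        if "x \<in> K" "z \<in> K" "x \<noteq> z" for x z
      proof -
        obtain p q where "x = Inl p" "z = Inl q"
          using base \<open>x \<in> K\<close> \<open>z \<in> K\<close> by blast
        then show ?thesis
          using pairwiseD[OF cl that] by (cases p; cases q) (simp add: comparable_Inl)
      qed
    qed
  next
    case guest
    show ?thesis
    proof (rule B.clique_le_image[of "snd \<circ> projr"])
      show "(snd \<circ> projr) ` K \<subseteq> W"
        using K guest by (auto simp: verts_def)
      show "comparable Q (Suc d) ((snd \<circ> projr) x) ((snd \<circ> projr) z)"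
        if "x \<in> K" "z \<in> K" "x \<noteq> z" for x z
      proof -
        obtain p q where "x = Inr p" "z = Inr q"
          using guest \<open>x \<in> K\<close> \<open>z \<in> K\<close> by blast
        then show ?thesis
          using pairwiseD[OF cl that] by (cases p; cases q) (simp add: comparable_Inr)
      qed
    qed
  next
    case (mixed x z)
    obtain y v where x: "x = (y, v)" by (cases x)
    obtain s w where z: "z = (s, w)" by (cases z)
    have down: "(Inr q, Inl p) \<in> rel d" if "Inr q \<in> K" "Inl p \<in> K" for p q
      using that cl comparable_Inr_Inl by (auto simp: pairwise_def)
    \<comment> \<open>Two adjacent base vertices share a copy \<open>y\<close>. Since the guest
      vertex \<open>z\<close> is below both, \<open>s\<close> sends a pair for each of them to
      \<open>y\<close>, and injectivity identifies the vertices.\<close>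
    have uniq: "p = x" if p: "Inl p \<in> K" for p
    proof (cases "p = x")
      case False
      obtain y' v' where p': "p = (y', v')" by (cases p)
      have "y' = y"
        using cl p mixed(1) False comparable_Inl unfolding pairwise_def x p' by blast
      then show ?thesis
        using down[OF mixed(2) p] down[OF mixed(2,1)] placement_inj[of s]
        unfolding x z p' rel_simps by metis
    qed
    have under: "p = Inl x \<or> (p, Inl x) \<in> rel d" if "p \<in> K" for p
    proof (cases p)
      case (Inl q)
      then show ?thesis
        using uniq that by blast
    next
      case (Inr q)
      then show ?thesis
        using down[OF _ mixed(1)] that by blast
    qed
    have total: "(p, q) \<in> rel d \<or> (q, p) \<in> rel d" if "p \<in> K" "q \<in> K" "p \<noteq> q" for p q
      using under[OF that(1)] under[OF that(2)] fork[of p "Inl x" q] pairwiseD[OF cl that] that(3)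
      by blast
    have "inj_on (level d) K"
      using total level_mono[of d] by (fastforce simp: inj_on_def)
    moreover have "level d ` K \<subseteq> {..<Suc j}"
      using K top_level_less by auto
    ultimately have "card K \<le> Suc j"
      using card_inj_on_le[of "level d" K "{..<Suc j}"] by simp
    then show ?thesis
      using j_less by simp
  qed
qed

lemma clique_ex: "\<exists>K\<subseteq>verts. pairwise (comparable rel (Suc d)) K \<and> card K = k"
proof -
  obtain K where K: "K \<subseteq> V" "pairwise (comparable R d) K" "card K = k"
    using A.clique_ex by blast
  \<comment> \<open>Copy 0 exists because \<open>copies\<close> is a successor.\<close>
  let ?K = "(\<lambda>v. Inl (0, v)) ` K"
  have "?K \<subseteq> verts"
    using K(1) by (auto simp: verts_def copies_def)
  moreover have "pairwise (comparable rel (Suc d)) ?K"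
  proof (rule pairwise_imageI)
    fix u v assume "u \<in> K" "v \<in> K" "u \<noteq> v"
    then obtain i where "i < d" "(u, v) \<in> R i \<or> (v, u) \<in> R i"
      using pairwiseD[OF K(2)] by (auto simp: comparable_def)
    then show "comparable rel (Suc d) (Inl (0, u)) (Inl (0, v))"
      unfolding comparable_def by (intro exI[of _ i]) (simp add: rel_simps copies_def)
  qed
  moreover have "card ?K = k"
    using K(3) by (subst card_image) (auto simp: inj_on_def)
  ultimately show ?thesis
    by blast
qed

text \<open>Pigeonhole finds a colour pattern with enough copies to hold an injective placement
  \<open>s\<close>. The guest of \<open>s\<close> and one copy with that pattern use disjoint sets
  of colours, so their bounds \<open>b\<close> and \<open>c\<close> add up.\<close>

lemma colours_ge:
  fixes f :: "_ \<Rightarrow> nat"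
  assumes f: "\<And>i x z. i < Suc d \<Longrightarrow> (x, z) \<in> rel i \<Longrightarrow> f x \<noteq> f z"
  shows "b + c \<le> card (f ` verts)"
proof (rule ccontr)
  assume "\<not> ?thesis"
  then have few: "card (f ` verts) \<le> b + c"
    by simp
  have fin: "finite (f ` verts)"
    using finite_verts by simp
  define type where "type y = (\<lambda>v\<in>V. f (Inl (y, v)))" for y
  define fibre where "fibre t = {y \<in> {..<copies}. type y = t}" for t
  have "type y \<in> V \<rightarrow>\<^sub>E f ` verts" if "y < copies" for y
    using that by (auto simp: type_def verts_def)
  then have cover: "{..<copies} \<subseteq> (\<Union>t \<in> V \<rightarrow>\<^sub>E f ` verts. fibre t)"
    by (auto simp: fibre_def)
  have finT: "finite (V \<rightarrow>\<^sub>E f ` verts)"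
    using A.finite_V fin by (auto intro: finite_PiE)
  have "\<exists>t. card (W \<times> V) < card (fibre t)"
  proof (rule ccontr)
    assume "\<not> ?thesis"
    then have small: "card (fibre t) \<le> card (W \<times> V)" for t
      by (simp add: not_less)
    have "copies \<le> card (\<Union>t \<in> V \<rightarrow>\<^sub>E f ` verts. fibre t)"
      using card_mono[OF _ cover] finT by (simp add: fibre_def)
    also have "\<dots> \<le> (\<Sum>t \<in> V \<rightarrow>\<^sub>E f ` verts. card (fibre t))"
      by (rule card_UN_le[OF finT])
    also have "\<dots> \<le> card (V \<rightarrow>\<^sub>E f ` verts) * card (W \<times> V)"
      using sum_bounded_above[of "V \<rightarrow>\<^sub>E f ` verts" "\<lambda>t. card (fibre t)"] small by simp
    also have "\<dots> \<le> (b + c) ^ card V * card (W \<times> V)"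
      using few A.finite_V by (intro mult_right_mono) (auto simp: card_PiE intro: power_mono)
    finally show False
      by (simp add: copies_def)
  qed
  then obtain t where t: "card (W \<times> V) < card (fibre t)"
    by blast
  \<comment> \<open>A reference copy for the pattern \<open>t\<close>; it represents the colours of
    all copies in the fibre.\<close>
  then obtain y where y: "y \<in> fibre t"
    by fastforce
  obtain s0 where s0: "s0 ` (W \<times> V) \<subseteq> fibre t" "inj_on s0 (W \<times> V)"
    using card_le_inj[of "W \<times> V" "fibre t"] t A.finite_V B.finite_V
    by (auto simp: fibre_def)
  \<comment> \<open>Restriction makes the injection extensional, as membership in
    \<open>placements\<close> demands.\<close>
  define s where "s = restrict s0 (W \<times> V)"
  have s: "s \<in> placements" and s_fibre: "\<And>w v. w \<in> W \<Longrightarrow> v \<in> V \<Longrightarrow> s (w, v) \<in> fibre t"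
    using s0 by (auto simp: s_def placements_def fibre_def inj_on_def image_subset_iff)
  have base: "c \<le> card ((\<lambda>v. f (Inl (y, v))) ` V)"
  proof (rule A.colours_ge)
    show "f (Inl (y, u)) \<noteq> f (Inl (y, v))" if "i < d" "(u, v) \<in> R i" for i u v
      using f[of i "Inl (y, u)" "Inl (y, v)"] y that by (simp add: fibre_def rel_simps)
  qed
  have guest: "b \<le> card ((\<lambda>w. f (Inr (s, w))) ` W)"
    using s f by (intro B.colours_ge) (auto simp: rel_simps)
  \<comment> \<open>The guest vertex \<open>w\<close> is adjacent to vertex \<open>v\<close> of copy
    \<open>s (w, v)\<close>, which has the same colour as vertex \<open>v\<close> of the reference
    copy \<open>y\<close>.\<close>
  have "f (Inr (s, w)) \<noteq> f (Inl (y, v))" if "w \<in> W" "v \<in> V" for w v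
  proof -
    have "type (s (w, v)) v = type y v"
      using y s_fibre[OF that] by (simp add: fibre_def)
    then have "f (Inl (s (w, v), v)) = f (Inl (y, v))"
      using that by (simp add: type_def)
    moreover have "(Inr (s, w), Inl (s (w, v), v)) \<in> rel d"
      using that s by (auto simp: rel_simps below_def)
    ultimately show ?thesis
      using f[of d] by fastforce
  qed
  then have "card ((\<lambda>w. f (Inr (s, w))) ` W \<union> (\<lambda>v. f (Inl (y, v))) ` V) =
      card ((\<lambda>w. f (Inr (s, w))) ` W) + card ((\<lambda>v. f (Inl (y, v))) ` V)"
    using A.finite_V B.finite_V by (intro card_Un_disjoint) auto
  moreover have "(\<lambda>w. f (Inr (s, w))) ` W \<union> (\<lambda>v. f (Inl (y, v))) ` V \<subseteq> f ` verts"
    using s y by (auto simp: verts_def fibre_def)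
  ultimately have "card ((\<lambda>w. f (Inr (s, w))) ` W) + card ((\<lambda>v. f (Inl (y, v))) ` V) \<le>
      card (f ` verts)"
    using card_mono[OF fin] by metis
  then show False
    using base guest \<open>\<not> b + c \<le> card (f ` verts)\<close> by linarith
qed

lemma layered_system_amalgam: "layered_system k d (b + c) verts rel level (Suc j)"
proof
  show "b + c \<le> card (f ` verts)"
    if "\<And>i x z. i < Suc d \<Longrightarrow> (x, z) \<in> rel i \<Longrightarrow> f x \<noteq> f z" for f :: "_ \<Rightarrow> nat"
    using that by (rule colours_ge)
qed (fact finite_verts rel_subset rel_trans level_mono level_less clique_le clique_ex
    top_level_less fork)+

end

section \<open>The nested inductions, on the number of layers and on the number of orders\<close>

lemma ex_layered_system:
  fixes V :: "nat set"
  assumes "order_system k d c V R h" and "k > 0" and "1 \<le> j" and "j \<le> k"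
  shows "\<exists>(W :: nat set) Q g. layered_system k d (j * c) W Q g j"
  using assms(3,4)
proof (induction j rule: dec_induct)
  case base
  then show ?case
    using order_system.layered_system_1[OF assms(1,2)] by auto
next
  case (step j)
  then obtain W :: "nat set" and Q g where "layered_system k d (j * c) W Q g j"
    by auto
  then interpret amalgam k d c V R h "j * c" W Q g j
    using assms(1) step.prems by (simp add: amalgam_def amalgam_axioms_def)
  obtain p where "bij_betw p {0..<card verts} verts"
    using ex_bij_betw_nat_finite[OF finite_verts] by blast
  from layered_system.relabel[OF layered_system_amalgam this] show ?case
    by (auto simp: add.commute)
qed

lemma ex_order_system:
  assumes "k > 0" and "d > 0"
  shows "\<exists>(V :: nat set) R h. order_system k d (k ^ d) V R h"
  using assms(2)
proof (induction d rule: nat_induct_non_zero)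
  case 1
  then show ?case
    using order_system_chain[of k] by auto
next
  case (Suc d)
  then obtain V :: "nat set" and R h where "order_system k d (k ^ d) V R h"
    by blast
  \<comment> \<open>With \<open>j = k\<close> the bound becomes \<open>k * k ^ d\<close>; forgetting
    the layers leaves an \<open>order_system\<close> with \<open>Suc d\<close> orders.\<close>
  from ex_layered_system[OF this, of k] assms(1) show ?case
    by (auto simp: layered_system_def)
qed

section \<open>From order systems to graphs, cliques and colourings\<close>

lemma pair_graphI:
  assumes "finite (pverts G)" and "\<And>u v. (u, v) \<in> parcs G \<Longrightarrow> u \<in> pverts G \<and> u \<noteq> v"
    and "\<And>u v. (u, v) \<in> parcs G \<Longrightarrow> (v, u) \<in> parcs G"
  shows "pair_graph G"
proof -
  have arcs: "parcs G \<subseteq> pverts G \<times> pverts G"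
    by (rule subrelI) (use assms(2,3) in blast)
  show ?thesis
  proof
    show "finite (parcs G)"
      using arcs assms(1) finite_subset by blast
    show "symmetric G"
      using assms(3) by (auto simp: symmetric_def arcs_ends_conv intro: symI)
  qed (use arcs assms(1,2) in auto)
qed

context order_system
begin

definition order_graph :: "nat \<Rightarrow> 'a pair_pre_digraph" where
  "order_graph i = \<lparr>pverts = V, parcs = R i \<union> (R i)\<inverse>\<rparr>"

definition union_graph :: "'a pair_pre_digraph" where
  "union_graph = \<lparr>pverts = V, parcs = {(u, v). comparable R d u v}\<rparr>"

lemma comparable_V: "comparable R d u v \<Longrightarrow> u \<in> V \<and> v \<in> V"
  using R_subset by (auto simp: comparable_def)

lemma comparability_graph_order_graph:
  assumes "i < d"
  shows "comparability_graph (order_graph i)"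
  unfolding comparability_graph_def
proof
  show "pair_graph (order_graph i)"
    using assms finite_V R_subset R_irrefl by (intro pair_graphI) (auto simp: order_graph_def)
  \<comment> \<open>Adding the diagonal makes the strict order reflexive; antisymmetry follows from
    the strict increase of levels.\<close>
  have "partial_order_on V (Id_on V \<union> R i)"
    unfolding partial_order_on_def preorder_on_def
  proof (intro conjI)
    show "antisym (Id_on V \<union> R i)"
      by (rule antisymI) (auto dest!: level_mono[OF assms])
    show "trans (Id_on V \<union> R i)"
      using R_trans[OF assms] unfolding trans_def by blast
  qed (use R_subset[OF assms] in \<open>auto simp: refl_on_def\<close>)
  then show "\<exists>r. partial_order_on (pverts (order_graph i)) r \<and>
      parcs (order_graph i) = {(u, v). u \<noteq> v \<and> ((u, v) \<in> r \<or> (v, u) \<in> r)}"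
    using R_irrefl[OF assms]
    by (intro exI[of _ "Id_on V \<union> R i"]) (auto simp: order_graph_def)
qed

lemma pair_graph_union_graph: "pair_graph union_graph"
  using finite_V comparable_V comparable_irrefl comparable_sym
  by (intro pair_graphI) (auto simp: union_graph_def)

text \<open>The orders are indexed from 0 and the graphs from 1, hence the shift. An empty family
  would have no vertices, so \<open>d > 0\<close> is assumed.\<close>

lemma union_graph_eq:
  assumes "d > 0"
  shows "union_graph = graph_Union (\<lambda>i. order_graph (i - 1)) {1..d}"
proof -
  have "{..<d} = (\<lambda>i. i - 1) ` {1..d}"
    by (force simp: image_iff intro: bexI[of _ "Suc _"])
  then have "graph_Union (\<lambda>i. order_graph (i - 1)) {1..d} =
      \<lparr>pverts = (\<Union>i<d. pverts (order_graph i)), parcs = (\<Union>i<d. parcs (order_graph i))\<rparr>"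
    by (simp add: graph_Union_def image_image)
  also have "\<dots> = union_graph"
    using assms by (auto simp: union_graph_def order_graph_def comparable_def)
  finally show ?thesis
    by simp
qed

lemma clique_union_graph:
  "clique union_graph K \<longleftrightarrow> K \<subseteq> V \<and> pairwise (comparable R d) K"
  by (auto simp: clique_def union_graph_def pairwise_def)

lemma clique_number_union_graph: "clique_number union_graph = k"
  unfolding clique_number_def
proof (rule Max_eqI)
  have "{card K |K. clique union_graph K} \<subseteq> {..k}"
    using clique_le by (auto simp: clique_union_graph)
  then show "finite {card K |K. clique union_graph K}"
    using finite_subset by blast
  show "k \<in> {card K |K. clique union_graph K}"
    using clique_ex by (auto simp: clique_union_graph)
qed (use clique_le in \<open>auto simp: clique_union_graph\<close>)

lemma chromatic_number_union_graph:
  assumes "c = k ^ d"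
  shows "chromatic_number union_graph = k ^ d"
  unfolding chromatic_number_def
proof (rule Least_equality)
  let ?P = "{..<d} \<rightarrow>\<^sub>E {..<k}"
  \<comment> \<open>\<open>e\<close> numbers the \<open>k ^ d\<close> conceivable level tuples, so
    that they can serve as natural-number colours.\<close>
  obtain e where "bij_betw e ?P {0..<card ?P}"
    using ex_bij_betw_finite_nat[of ?P] by (auto intro: finite_PiE)
  then have e: "inj_on e ?P" "\<And>x. x \<in> ?P \<Longrightarrow> e x < k ^ d"
    by (auto simp: bij_betw_def card_PiE)
  define l where "l v = (\<lambda>i\<in>{..<d}. h i v)" for v
  have l: "l v \<in> ?P" if "v \<in> V" for v
    using that level_less by (auto simp: l_def)
  have "e (l u) \<noteq> e (l v)" if uv: "comparable R d u v" for u v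
  proof -
    obtain i where "i < d" "(u, v) \<in> R i \<or> (v, u) \<in> R i"
      using uv by (auto simp: comparable_def)
    then have "l u i \<noteq> l v i"
      using level_mono by (fastforce simp: l_def)
    then have "l u \<noteq> l v"
      by auto
    then show ?thesis
      using e(1) l comparable_V[OF uv] by (auto dest: inj_onD)
  qed
  then have "proper_coloring union_graph (k ^ d) (e \<circ> l)"
    using e(2) l by (auto simp: proper_coloring_def union_graph_def)
  then show "\<exists>f. proper_coloring union_graph (k ^ d) f"
    by blast
next
  fix n assume "\<exists>f. proper_coloring union_graph n f"
  then obtain f where f: "proper_coloring union_graph n f"
    by blast
  have "k ^ d \<le> card (f ` V)"
    unfolding assms[symmetric]
  proof (rule colours_ge)
    show "f u \<noteq> f v" if "i < d" "(u, v) \<in> R i" for i u v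
      using f that by (auto simp: proper_coloring_def union_graph_def comparable_def)
  qed
  also have "\<dots> \<le> card {..<n}"
    using f by (intro card_mono) (auto simp: proper_coloring_def union_graph_def)
  finally show "k ^ d \<le> n"
    by simp
qed

end

theorem theorem1:
  fixes k d :: nat
  assumes "k > 0" and "d > 0"
  shows "\<exists>(G :: nat pair_pre_digraph) (H :: nat \<Rightarrow> nat pair_pre_digraph).
           pair_graph G \<and>
           (\<forall>i\<in>{1..d}. comparability_graph (H i)) \<and>
           G = graph_Union H {1..d} \<and>
           clique_number G = k \<and>
           chromatic_number G = k ^ d"
proof -
  obtain V :: "nat set" and R h where "order_system k d (k ^ d) V R h"
    using ex_order_system[OF assms] by blast
  then interpret order_system k d "k ^ d" V R h .
  show ?thesis
  proof (intro exI conjI)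
    show "\<forall>i\<in>{1..d}. comparability_graph (order_graph (i - 1))"
      using comparability_graph_order_graph by auto
  qed (fact pair_graph_union_graph union_graph_eq[OF assms(2)] clique_number_union_graph
      chromatic_number_union_graph[OF refl])+
qed

end
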